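(* Let $n\geq 1$ and let $M\in\mathbb{R}^{n\times n}$ be a primitive matrix. If there exists a positive vector $\mathbf{x}=(x_1,\dots,x_n)^t\in\mathbb{R}_{>0}^n$ such that $M\mathbf{x}=\left(\frac{1}{x_1},\dots,\frac{1}{x_n}\right)^t$, then it is unique; that is, at most one vector $\mathbf{x}\in\mathbb{R}_{>0}^n$ satisfies this equation.
   Context: A primitive matrix is a square matrix with nonnegative real entries some power of which has all entries positive. A vector is positive if all of its entries are positive. *)

theory Defs
  imports "HOL-Analysis.Analysis"
begin

(* The overloaded power operation on type vec is entrywise, so the power with
   respect to the matrix product needs its own definition. *)
primrec matrix_power :: "real^'n^'n \<Rightarrow> nat \<Rightarrow> real^'n^'n" where
  "matrix_power M 0 = mat 1"
| "matrix_power M (Suc k) = M ** matrix_power M k"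

(* The exponent must be at least 1: otherwise the 1 x 1 zero matrix, whose
   zeroth power is the identity, would count as primitive. *)
definition primitive_matrix :: "real^'n^'n \<Rightarrow> bool" where
  "primitive_matrix M \<longleftrightarrow>
     (\<forall>i j. 0 \<le> M $ i $ j) \<and>
     (\<exists>k\<ge>1. \<forall>i j. 0 < matrix_power M k $ i $ j)"

definition positive_vector :: "real^'n \<Rightarrow> bool" where
  "positive_vector x \<longleftrightarrow> (\<forall>i. 0 < x $ i)"

end

(* For two solutions x and y put r_i = y_i / x_i and s = min r. The matrix with entries
   x_i M_ij x_j is row stochastic and maps r to its entrywise inverse, so averaging the
   bound s <= r gives r <= 1/s. The equality cases say that every edge leaving an index
   with r = s ends at one with r = 1/s, and conversely. Walks of a length k with M^k > 0
   reach every index, so r is constant, and then the equation forces r = 1. *)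
theory Submission
  imports Defs
begin

text \<open>A positive entry of \<open>matrix_power M k\<close> yields a walk of \<open>k\<close>
  edges along positive entries of \<open>M\<close>, and each edge switches between \<open>S\<close>
  and \<open>T\<close>.\<close>

lemma matrix_power_pos_alternating:
  fixes M :: "real^'n^'n"
  assumes nonneg: "\<And>i j. 0 \<le> M $ i $ j"
    and "\<And>i j. i \<in> S \<Longrightarrow> 0 < M $ i $ j \<Longrightarrow> j \<in> T"
    and "\<And>i j. i \<in> T \<Longrightarrow> 0 < M $ i $ j \<Longrightarrow> j \<in> S"
    and "i \<in> S" and "0 < matrix_power M k $ i $ j"
  shows "j \<in> (if even k then S else T)"
  using assms(2-5)
proof (induction k arbitrary: i S T)
  case 0
  then show ?case by (simp add: mat_def split: if_splits)
next
  case (Suc k)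
  have "(\<Sum>l\<in>UNIV. M $ i $ l * matrix_power M k $ l $ j) > 0"
    using Suc.prems(4) by (simp add: matrix_matrix_mult_def)
  then obtain l where l: "M $ i $ l * matrix_power M k $ l $ j > 0"
    by (meson not_le sum_nonpos)
  with nonneg[of i l] have edge: "0 < M $ i $ l" and walk: "0 < matrix_power M k $ l $ j"
    by (auto simp: zero_less_mult_iff)
  have "l \<in> T" using Suc.prems(1,3) edge by blast
  \<comment> \<open>The remaining walk starts in \<open>T\<close>, so the induction hypothesis is
    used with \<open>S\<close> and \<open>T\<close> exchanged.\<close>
  then have "j \<in> (if even k then T else S)"
    using Suc.IH[of T S l] Suc.prems(1,2) walk by blast
  then show ?case by (simp split: if_splits)
qed

text \<open>The sum over \<open>j\<close> of \<open>M $ i $ j * (y $ j - c * x $ j)\<close> has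
  nonnegative terms, and the two equations evaluate it to
  \<open>(x $ i - c * y $ i) / (x $ i * y $ i)\<close>. Its sign gives the bound; if it vanishes, so
  does every term.\<close>

lemma reciprocal_solution_compare:
  fixes M :: "real^'n^'n"
  assumes nonneg: "\<And>i j. 0 \<le> M $ i $ j"
    and "positive_vector x" "M *v x = (\<chi> i. 1 / x $ i)"
    and "positive_vector y" "M *v y = (\<chi> i. 1 / y $ i)"
    and le: "\<And>j. c * x $ j \<le> y $ j"
  shows "c * y $ i \<le> x $ i"
    and "c * y $ i = x $ i \<Longrightarrow> 0 < M $ i $ j \<Longrightarrow> y $ j = c * x $ j"
proof -
  let ?f = "\<lambda>j. M $ i $ j * (y $ j - c * x $ j)"
  have pos: "0 < x $ i" "0 < y $ i"
    using assms(2,4) by (auto simp: positive_vector_def)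
  have "(\<Sum>j\<in>UNIV. ?f j) = (M *v y) $ i - c * (M *v x) $ i"
    by (simp add: matrix_vector_mult_def algebra_simps sum_subtractf sum_distrib_left)
  also have "\<dots> = (x $ i - c * y $ i) / (x $ i * y $ i)"
    using pos by (simp add: assms(3,5) field_simps)
  finally have eq: "(\<Sum>j\<in>UNIV. ?f j) = (x $ i - c * y $ i) / (x $ i * y $ i)" .
  have nn: "0 \<le> ?f j" for j
    using nonneg le by simp
  then have "0 \<le> (\<Sum>j\<in>UNIV. ?f j)"
    by (rule sum_nonneg)
  then show "c * y $ i \<le> x $ i"
    using mult_pos_pos[OF pos] by (simp add: eq zero_le_divide_iff)
  assume "c * y $ i = x $ i" "0 < M $ i $ j"
  then have "(\<Sum>j\<in>UNIV. ?f j) = 0" using eq by simp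
  then have "?f j = 0" using nn by (simp add: sum_nonneg_eq_0_iff)
  with \<open>0 < M $ i $ j\<close> show "y $ j = c * x $ j" by simp
qed

text \<open>Scaling by \<open>c\<close> multiplies the left side of the equation by \<open>c\<close>
  and divides the right side by \<open>c\<close>, so \<open>c * c = 1\<close>.\<close>

lemma reciprocal_solution_scaled:
  fixes M :: "real^'n^'n"
  assumes "positive_vector x" "M *v x = (\<chi> i. 1 / x $ i)"
    and "M *v (c *\<^sub>R x) = (\<chi> i. 1 / (c *\<^sub>R x) $ i)" and "0 < c"
  shows "c *\<^sub>R x = x"
proof -
  fix i
  have pos: "0 < x $ i" using assms(1) by (simp add: positive_vector_def)
  have "c * (M *v x) $ i = 1 / (c * x $ i)"
    using arg_cong[OF assms(3), of "\<lambda>v. v $ i"]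
    by (simp add: matrix_vector_mult_scaleR)
  then have "c * c = 1"
    using pos \<open>0 < c\<close> by (simp add: assms(2) field_simps)
  then have "c = 1"
    using \<open>0 < c\<close> by (auto simp: square_eq_1_iff)
  then show ?thesis by simp
qed

theorem proposition4:
  fixes M :: "real^'n^'n"
  assumes "primitive_matrix M"
  shows "\<exists>\<^sub>\<le>\<^sub>1 x. positive_vector x \<and> M *v x = (\<chi> i. 1 / x $ i)"
proof (rule Uniq_I)
  fix x y :: "real^'n"
  assume "positive_vector x \<and> M *v x = (\<chi> i. 1 / x $ i)"
    and "positive_vector y \<and> M *v y = (\<chi> i. 1 / y $ i)"
  then have x: "positive_vector x" "M *v x = (\<chi> i. 1 / x $ i)"
    and y: "positive_vector y" "M *v y = (\<chi> i. 1 / y $ i)"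
    by auto
  have pos: "0 < x $ i" "0 < y $ i" for i
    using x(1) y(1) by (auto simp: positive_vector_def)
  obtain k where nonneg: "\<And>i j. 0 \<le> M $ i $ j" and k: "\<And>i j. 0 < matrix_power M k $ i $ j"
    using assms by (auto simp: primitive_matrix_def)
  let ?r = "\<lambda>i. y $ i / x $ i"
  obtain p where p: "\<And>i. ?r p \<le> ?r i"
    using arg_min_if_finite(2)[of UNIV ?r] by (metis UNIV_I UNIV_not_empty finite not_le)
  define s where "s = ?r p"
  have s: "0 < s" using pos by (simp add: s_def)
  have lower: "s * x $ j \<le> y $ j" for j
    using p[of j] pos(1)[of j] by (simp add: s_def pos_le_divide_eq)
  note above = reciprocal_solution_compare[OF nonneg x y lower]
  have upper: "s * y $ j \<le> x $ j" for j
    using above(1) .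
  \<comment> \<open>The bound \<open>upper\<close> is \<open>lower\<close> with \<open>x\<close> and
    \<open>y\<close> exchanged and the same constant \<open>s\<close>, so the comparison applies
    again; its equality case now leads from \<open>S\<close> to \<open>T\<close>.\<close>
  note below = reciprocal_solution_compare[OF nonneg y x upper]
  define S where "S = {i. y $ i = s * x $ i}"
  define T where "T = {i. x $ i = s * y $ i}"
  have "p \<in> S"
    using pos(1)[of p] by (simp add: S_def s_def)
  have ST: "j \<in> T" if "i \<in> S" "0 < M $ i $ j" for i j
    using that below(2)[of i j] by (simp add: S_def T_def)
  have TS: "j \<in> S" if "i \<in> T" "0 < M $ i $ j" for i j
    using that above(2)[of i j] by (simp add: S_def T_def)
  \<comment> \<open>Row \<open>p\<close> of the \<open>k\<close>-th power is positive everywhere, so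
    a single set, chosen by the parity of \<open>k\<close>, contains all indices. Hence one solution
    is \<open>s\<close> times the other.\<close>
  have all: "j \<in> (if even k then S else T)" for j
    using matrix_power_pos_alternating[OF nonneg ST TS \<open>p \<in> S\<close> k] .
  show "x = y"
  proof (cases "even k")
    case True
    then have "y = s *\<^sub>R x" using all by (simp add: S_def vec_eq_iff)
    then show ?thesis using reciprocal_solution_scaled x y(2) s by metis
  next
    case False
    then have "x = s *\<^sub>R y" using all by (simp add: T_def vec_eq_iff)
    then show ?thesis using reciprocal_solution_scaled y x(2) s by metis
  qed
qed

end
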